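(* Suppose i.i.d. panel sampling, overlap, and no anticipation in the staggered design hold (see context). Let $g$ be an eventually treated group with $\gamma(g)\ge2$, and let $0\le e\le\bar e\le\mathcal T-\gamma(g)$. (i) If parallel trends in the staggered design (PT-stg) holds, then $$\mathrm{ATT}(g,\gamma(g)+e)=\mathbb E[\phi^{g,e}(S;m_{\Delta,g,\gamma(g)+e},\tilde p,\tilde w^g;\pi_g)]=\mathbb E[\phi^{g,e}(S;\tilde m_{\Delta,g,\gamma(g)+e},p,\tilde w^g;\pi_g)]$$ for any weight functions $\tilde w^g=(\tilde w^g_{g'})_{g'\in\mathcal D_{g,\bar e}}$ with $\sum_{g'\in\mathcal D_{g,\bar e}}\tilde w^g_{g'}(x)=1$ for all $x\in\mathcal X$, any non-zero functions $\tilde p$, and any function $\tilde m_{\Delta,g,\gamma(g)+e}$ (such that the displayed expectations exist). (ii) If synthetic control in the staggered design (SC-stg) holds, then $$\mathrm{ATT}(g,\gamma(g)+e)=\mathbb E[\phi^{g,e}(S;\tilde m_{\Delta,g,\gamma(g)+e},p,w^g;\pi_g)]$$ for any function $\tilde m_{\Delta,g,\gamma(g)+e}$ (such that the expectation exists), where $w^g$ is the vector of weight functions in (SC-stg).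
   Context: Setting. There are $N_G+1$ groups; $G\in\{1,\dots,N_G+1\}$, $\mathcal G_g=\mathbf 1\{G=g\}$; periods $t=1,\dots,\mathcal T$. Treatment is irreversible and its adoption time is determined by the group: $\gamma(g)\in\{1,\dots,\mathcal T\}\cup\{\infty\}$ is the first treated period of group $g$ ($\infty$ if never treated; $g$ is eventually treated if $\gamma(g)<\infty$). $Y_t(s)$ is the (integrable) potential outcome at time $t$ had the adoption time been $s$; $Y_t(\infty)$ is the never-treated potential outcome. Observed outcome: $Y_t=\sum_{g=1}^{N_G+1}\mathcal G_gY_t(\gamma(g))$. $X$ is a vector of covariates with support $\mathcal X$. Target: $\mathrm{ATT}(g,t)=\mathbb E[Y_t(\gamma(g))-Y_t(\infty)\mid G=g]$ for $t\ge\gamma(g)$. Donor set: $\mathcal D_{g,\bar e}=\{g':\gamma(g')>\gamma(g)+\bar e\}$ for a fixed integer $\bar e\ge0$. Assumptions. Panel sampling: an i.i.d. sample of $S=(Y_1,\dots,Y_{\mathcal T},G,X)$ is observed. Overlap: $p_g(X)=\mathbb P(G=g\mid X)>0$ a.s. for all $g$. No anticipation: for $t<\gamma(g)$, $Y_t(\gamma(g))=Y_t(\infty)$. (PT-stg): for any $g$ and $g'$ with $g'\in\mathcal D_{g,\bar e}$, $\mathbb E[Y_t(\infty)-Y_{t-1}(\infty)\mid G=g,X]=\mathbb E[Y_t(\infty)-Y_{t-1}(\infty)\mid G=g',X]$ for $\gamma(g)\le t\le\gamma(g)+\bar e$. (SC-stg): for each eventually treated group $g$ there is a vector of weight functions $w^g=(w^g_{g'},g'\in\mathcal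 D_{g,\bar e})$ whose elements sum to one such that for almost all $x\in\mathcal X$, $\mathbb E[Y_t(\infty)\mid G=g,X=x]=\sum_{g'\in\mathcal D_{g,\bar e}}w^g_{g'}(x)\mathbb E[Y_t(\infty)\mid G=g',X=x]$ for $t=1,\dots,\gamma(g)+\bar e$; furthermore $\gamma(g)\ge|\mathcal D_{g,\bar e}|\ge2$ for all such $g$. (In both assumptions time indices are restricted to $\{1,\dots,\mathcal T\}$.) Notation. $\pi_g=\mathbb P(G=g)$; $m_{\Delta,g,\gamma(g)+e}(x)=\mathbb E[Y_{\gamma(g)+e}-Y_{\gamma(g)-1}\mid G\in\mathcal D_{g,\bar e},X=x]$; and $$\phi^{g,e}(S;m_{\Delta,g,\gamma(g)+e},p,w^g;\pi_g)=\frac1{\pi_g}\Big(\mathcal G_g-\sum_{g'\in\mathcal D_{g,\bar e}}w^g_{g'}(X)\frac{p_g(X)}{p_{g'}(X)}\mathcal G_{g'}\Big)\big(Y_{\gamma(g)+e}-Y_{\gamma(g)-1}-m_{\Delta,g,\gamma(g)+e}(X)\big).$$ *)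

theory Defs
  imports "HOL-Probability.Probability"
begin

section \<open>Conditional expectations given an event and the covariates\<close>

definition sigma_of :: "'a measure \<Rightarrow> ('a \<Rightarrow> 'x::euclidean_space) \<Rightarrow> 'a measure" where
  "sigma_of M X = vimage_algebra (space M) X borel"

text \<open>
  E[Z | A, X], as a random variable: the conditional expectation given X, taken under the
  conditional probability P( . | A). It is unique up to P( . | A)-null sets; when
  P(A | X) > 0 almost surely, this is the same as uniqueness up to P-null sets.
\<close>

definition cond_exp_event ::
  "'a measure \<Rightarrow> ('a \<Rightarrow> 'x::euclidean_space) \<Rightarrow> 'a set \<Rightarrow> ('a \<Rightarrow> real) \<Rightarrow> 'a \<Rightarrow> real" where
  "cond_exp_event M X A Z = real_cond_exp (uniform_measure M A) (sigma_of M X) Z"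

text \<open>
  Functions of the covariate value are only determined up to null sets, so being
  ``the function x |-> E[Z | X = x]'' is a property of h (h is a version of it); the
  second definition is the analogue for x |-> E[Z | A, X = x].
\<close>

definition regression ::
  "'a measure \<Rightarrow> ('a \<Rightarrow> 'x::euclidean_space) \<Rightarrow> ('a \<Rightarrow> real) \<Rightarrow> ('x \<Rightarrow> real) \<Rightarrow> bool" where
  "regression M X Z h \<longleftrightarrow>
     h \<in> borel_measurable borel \<and>
     (AE \<omega> in M. h (X \<omega>) = real_cond_exp M (sigma_of M X) Z \<omega>)"

definition regression_event ::
  "'a measure \<Rightarrow> ('a \<Rightarrow> 'x::euclidean_space) \<Rightarrow> 'a set \<Rightarrow> ('a \<Rightarrow> real) \<Rightarrow> ('x \<Rightarrow> real) \<Rightarrow> bool" where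
  "regression_event M X A Z h \<longleftrightarrow>
     h \<in> borel_measurable borel \<and>
     (AE \<omega> in uniform_measure M A. h (X \<omega>) = cond_exp_event M X A Z \<omega>)"

definition cov_support :: "'a measure \<Rightarrow> ('a \<Rightarrow> 'x::euclidean_space) \<Rightarrow> 'x set" where
  "cov_support M X = {x. \<forall>U. open U \<and> x \<in> U \<longrightarrow> 0 < measure M (X -` U \<inter> space M)}"


section \<open>The staggered design\<close>

definition groups :: "nat \<Rightarrow> nat set" where
  "groups NG = {1..NG + 1}"

definition adoption_times :: "nat \<Rightarrow> enat set" where
  "adoption_times T = enat ` {1..T} \<union> {\<infinity>}"

text \<open>
  In the following, \<^term>\<open>Y t s\<close> is the potential outcome in period t under adoption
  time s, and \<^term>\<open>\<gamma> g\<close> is the first treated period of group g.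
\<close>

definition staggered_design ::
  "'a measure \<Rightarrow> nat \<Rightarrow> nat \<Rightarrow> (nat \<Rightarrow> enat) \<Rightarrow> ('a \<Rightarrow> nat) \<Rightarrow> ('a \<Rightarrow> 'x::euclidean_space)
     \<Rightarrow> (nat \<Rightarrow> enat \<Rightarrow> 'a \<Rightarrow> real) \<Rightarrow> bool" where
  "staggered_design M NG T \<gamma> G X Y \<longleftrightarrow>
     prob_space M \<and>
     G \<in> M \<rightarrow>\<^sub>M count_space UNIV \<and>
     (\<forall>\<omega>\<in>space M. G \<omega> \<in> groups NG) \<and>
     X \<in> M \<rightarrow>\<^sub>M borel \<and>
     (\<forall>g\<in>groups NG. \<gamma> g \<in> adoption_times T) \<and>
     (\<forall>t\<in>{1..T}. \<forall>s\<in>adoption_times T. integrable M (Y t s))"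

definition group_event :: "'a measure \<Rightarrow> ('a \<Rightarrow> nat) \<Rightarrow> nat set \<Rightarrow> 'a set" where
  "group_event M G B = {\<omega> \<in> space M. G \<omega> \<in> B}"

definition Yobs ::
  "nat \<Rightarrow> (nat \<Rightarrow> enat) \<Rightarrow> ('a \<Rightarrow> nat) \<Rightarrow> (nat \<Rightarrow> enat \<Rightarrow> 'a \<Rightarrow> real) \<Rightarrow> nat \<Rightarrow> 'a \<Rightarrow> real" where
  "Yobs NG \<gamma> G Y t \<omega> = (\<Sum>g\<in>groups NG. of_bool (G \<omega> = g) * Y t (\<gamma> g) \<omega>)"

text \<open>The observed vector S, consisting of the outcome path, the group and the covariates.\<close>

definition obs ::
  "nat \<Rightarrow> nat \<Rightarrow> (nat \<Rightarrow> enat) \<Rightarrow> ('a \<Rightarrow> nat) \<Rightarrow> ('a \<Rightarrow> 'x) \<Rightarrow> (nat \<Rightarrow> enat \<Rightarrow> 'a \<Rightarrow> real)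
     \<Rightarrow> 'a \<Rightarrow> (nat \<Rightarrow> real) \<times> nat \<times> 'x" where
  "obs NG T \<gamma> G X Y \<omega> = (\<lambda>t\<in>{1..T}. Yobs NG \<gamma> G Y t \<omega>, G \<omega>, X \<omega>)"

definition obs_space :: "nat \<Rightarrow> ((nat \<Rightarrow> real) \<times> nat \<times> 'x::euclidean_space) measure" where
  "obs_space T = (\<Pi>\<^sub>M t\<in>{1..T}. borel) \<Otimes>\<^sub>M (count_space UNIV \<Otimes>\<^sub>M borel)"

definition donors :: "nat \<Rightarrow> (nat \<Rightarrow> enat) \<Rightarrow> nat \<Rightarrow> nat \<Rightarrow> nat set" where
  "donors NG \<gamma> ebar g = {g' \<in> groups NG. \<gamma> g' > \<gamma> g + enat ebar}"

definition ATT ::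
  "'a measure \<Rightarrow> (nat \<Rightarrow> enat) \<Rightarrow> ('a \<Rightarrow> nat) \<Rightarrow> (nat \<Rightarrow> enat \<Rightarrow> 'a \<Rightarrow> real)
     \<Rightarrow> nat \<Rightarrow> nat \<Rightarrow> real" where
  "ATT M \<gamma> G Y g t =
     (\<integral>\<omega>. (Y t (\<gamma> g) \<omega> - Y t \<infinity> \<omega>) \<partial>uniform_measure M (group_event M G {g}))"


section \<open>Assumptions\<close>

text \<open>
  An i.i.d. sample S 0, ..., S (n - 1), defined on its own probability space Q, from the
  distribution that the random vector Z has under M.
\<close>

definition iid_sample ::
  "'q measure \<Rightarrow> nat \<Rightarrow> (nat \<Rightarrow> 'q \<Rightarrow> 's) \<Rightarrow> 'a measure \<Rightarrow> 's measure \<Rightarrow> ('a \<Rightarrow> 's) \<Rightarrow> bool" where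
  "iid_sample Q n S M N Z \<longleftrightarrow>
     prob_space Q \<and>
     prob_space.indep_vars Q (\<lambda>_. N) S {..<n} \<and>
     (\<forall>i<n. distr Q N (S i) = distr M N Z)"

definition overlap ::
  "'a measure \<Rightarrow> nat \<Rightarrow> ('a \<Rightarrow> nat) \<Rightarrow> ('a \<Rightarrow> 'x::euclidean_space) \<Rightarrow> bool" where
  "overlap M NG G X \<longleftrightarrow>
     (\<forall>g\<in>groups NG.
        AE \<omega> in M. 0 < real_cond_exp M (sigma_of M X) (indicator (group_event M G {g})) \<omega>)"

definition no_anticipation ::
  "'a measure \<Rightarrow> nat \<Rightarrow> nat \<Rightarrow> (nat \<Rightarrow> enat) \<Rightarrow> (nat \<Rightarrow> enat \<Rightarrow> 'a \<Rightarrow> real) \<Rightarrow> bool" where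
  "no_anticipation M NG T \<gamma> Y \<longleftrightarrow>
     (\<forall>g\<in>groups NG. \<forall>t\<in>{1..T}. enat t < \<gamma> g \<longrightarrow> (AE \<omega> in M. Y t (\<gamma> g) \<omega> = Y t \<infinity> \<omega>))"

text \<open>Both t and t - 1 have to be periods, hence the range of t starts at 2.\<close>

definition PT_stg ::
  "'a measure \<Rightarrow> nat \<Rightarrow> nat \<Rightarrow> (nat \<Rightarrow> enat) \<Rightarrow> ('a \<Rightarrow> nat) \<Rightarrow> ('a \<Rightarrow> 'x::euclidean_space)
     \<Rightarrow> (nat \<Rightarrow> enat \<Rightarrow> 'a \<Rightarrow> real) \<Rightarrow> nat \<Rightarrow> bool" where
  "PT_stg M NG T \<gamma> G X Y ebar \<longleftrightarrow>
     (\<forall>g\<in>groups NG. \<forall>g'\<in>donors NG \<gamma> ebar g. \<forall>t\<in>{2..T}.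
        \<gamma> g \<le> enat t \<and> enat t \<le> \<gamma> g + enat ebar \<longrightarrow>
        (AE \<omega> in M.
           cond_exp_event M X (group_event M G {g}) (\<lambda>\<omega>. Y t \<infinity> \<omega> - Y (t - 1) \<infinity> \<omega>) \<omega> =
           cond_exp_event M X (group_event M G {g'}) (\<lambda>\<omega>. Y t \<infinity> \<omega> - Y (t - 1) \<infinity> \<omega>) \<omega>))"

definition weight_functions :: "nat set \<Rightarrow> 'x::euclidean_space set \<Rightarrow> (nat \<Rightarrow> 'x \<Rightarrow> real) \<Rightarrow> bool" where
  "weight_functions D XX w \<longleftrightarrow>
     (\<forall>g'\<in>D. w g' \<in> borel_measurable borel) \<and> (\<forall>x\<in>XX. (\<Sum>g'\<in>D. w g' x) = 1)"

text \<open>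
  The vector w is a vector of synthetic control weights for group g. The identity holds for
  almost all x with respect to the distribution of X, that is, at x = X almost surely.
\<close>

definition SC_weights ::
  "'a measure \<Rightarrow> nat \<Rightarrow> nat \<Rightarrow> (nat \<Rightarrow> enat) \<Rightarrow> ('a \<Rightarrow> nat) \<Rightarrow> ('a \<Rightarrow> 'x::euclidean_space)
     \<Rightarrow> (nat \<Rightarrow> enat \<Rightarrow> 'a \<Rightarrow> real) \<Rightarrow> nat \<Rightarrow> nat \<Rightarrow> (nat \<Rightarrow> 'x \<Rightarrow> real) \<Rightarrow> bool" where
  "SC_weights M NG T \<gamma> G X Y ebar g w \<longleftrightarrow>
     weight_functions (donors NG \<gamma> ebar g) (cov_support M X) w \<and>
     (\<forall>t\<in>{1..T}. enat t \<le> \<gamma> g + enat ebar \<longrightarrow>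
        (AE \<omega> in M.
           cond_exp_event M X (group_event M G {g}) (Y t \<infinity>) \<omega> =
           (\<Sum>g'\<in>donors NG \<gamma> ebar g.
              w g' (X \<omega>) * cond_exp_event M X (group_event M G {g'}) (Y t \<infinity>) \<omega>)))"

definition SC_stg ::
  "'a measure \<Rightarrow> nat \<Rightarrow> nat \<Rightarrow> (nat \<Rightarrow> enat) \<Rightarrow> ('a \<Rightarrow> nat) \<Rightarrow> ('a \<Rightarrow> 'x::euclidean_space)
     \<Rightarrow> (nat \<Rightarrow> enat \<Rightarrow> 'a \<Rightarrow> real) \<Rightarrow> nat \<Rightarrow> bool" where
  "SC_stg M NG T \<gamma> G X Y ebar \<longleftrightarrow>
     (\<forall>g\<in>groups NG. \<gamma> g \<noteq> \<infinity> \<longrightarrow>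
        (\<exists>w. SC_weights M NG T \<gamma> G X Y ebar g w) \<and>
        enat (card (donors NG \<gamma> ebar g)) \<le> \<gamma> g \<and>
        2 \<le> card (donors NG \<gamma> ebar g))"


section \<open>The moment function\<close>

text \<open>
  The first argument \<^term>\<open>D\<close> is the donor set of g, and \<^term>\<open>s\<close> is the (finite) first treated
  period of g.
\<close>

definition phi ::
  "nat set \<Rightarrow> nat \<Rightarrow> nat \<Rightarrow> nat \<Rightarrow> (nat \<Rightarrow> real) \<times> nat \<times> 'x
     \<Rightarrow> ('x \<Rightarrow> real) \<Rightarrow> (nat \<Rightarrow> 'x \<Rightarrow> real) \<Rightarrow> (nat \<Rightarrow> 'x \<Rightarrow> real) \<Rightarrow> real \<Rightarrow> real" where
  "phi D s g e S m p w \<pi> = (case S of (y, k, x) \<Rightarrow>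
     1 / \<pi> *
     (of_bool (k = g) - (\<Sum>g'\<in>D. w g' x * (p g x / p g' x) * of_bool (k = g'))) *
     (y (s + e) - y (s - 1) - m x))"

end

theory Submission
  imports Defs
begin

text \<open>
  Up to null sets, \<open>\<pi>\<close> times the moment function is the effect of the treatment on group \<open>g\<close> plus a
  weighted sum of residuals \<open>R - m(X)\<close>, where \<open>R\<close> is the never-treated trend from \<open>s - 1\<close> to
  \<open>s + e\<close>; the weights are 1 on group \<open>g\<close> and \<open>- w k (X) p g (X) / p k (X)\<close> on donor group \<open>k\<close>.
  Given \<open>X\<close>, this sum has mean \<open>P g (H g - m) - (\<Sum>k. w k (p g / p k) P k (H k - m))\<close>, where
  \<open>P k\<close> is the true propensity and \<open>H k\<close> the mean of \<open>R\<close> in group \<open>k\<close>. It vanishes when \<open>m\<close> is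
  the correct regression under parallel trends, since then all \<open>H k\<close> equal \<open>m\<close>, and it vanishes
  when \<open>p = P\<close> and \<open>H g = (\<Sum>k. w k H k)\<close>, which both assumptions imply.
\<close>

section \<open>Conditioning on an event of positive probability\<close>

lemma (in finite_measure)
  fixes f :: "'a \<Rightarrow> real"
  assumes A [measurable]: "A \<in> sets M" and pos: "0 < measure M A"
    and f [measurable]: "f \<in> borel_measurable M"
  shows integrable_uniform_measure_iff:
      "integrable (uniform_measure M A) f \<longleftrightarrow> integrable M (\<lambda>x. indicator A x * f x)"
    and integral_uniform_measure_eq:
      "(\<integral>x. f x \<partial>uniform_measure M A) = (\<integral>x. indicator A x * f x \<partial>M) / measure M A"
proof -
  \<comment> \<open>With a real-valued density under \<open>ennreal\<close>, both claims become the
    usual density rules, up to the constant factor \<open>1 / measure M A\<close>.\<close>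
  have eq: "uniform_measure M A = density M (\<lambda>x. ennreal (indicator A x / measure M A))"
    unfolding uniform_measure_def emeasure_eq_measure using pos
    by (intro density_cong AE_I2) (auto simp: divide_ennreal[symmetric] split: split_indicator)
  have "integrable (uniform_measure M A) f \<longleftrightarrow>
      integrable M (\<lambda>x. (1 / measure M A) * (indicator A x * f x))"
    unfolding eq using pos by (subst integrable_density) auto
  then show "integrable (uniform_measure M A) f \<longleftrightarrow> integrable M (\<lambda>x. indicator A x * f x)"
    using pos by (subst (asm) integrable_mult_left_iff) auto
  have "(\<integral>x. f x \<partial>uniform_measure M A) =
      (\<integral>x. (1 / measure M A) * (indicator A x * f x) \<partial>M)"
    unfolding eq using pos by (subst integral_density) auto
  then show "(\<integral>x. f x \<partial>uniform_measure M A) =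
      (\<integral>x. indicator A x * f x \<partial>M) / measure M A"
    by simp
qed

lemma finite_measure_subalgebra_uniform_measure:
  assumes "finite_measure_subalgebra M F" "0 < measure M A"
  shows "finite_measure_subalgebra (uniform_measure M A) F"
proof -
  interpret finite_measure_subalgebra M F by fact
  interpret U: prob_space "uniform_measure M A"
    using assms(2) by (intro prob_space_uniform_measure) (auto simp: emeasure_eq_measure)
  show ?thesis
    using subalg by unfold_locales (auto simp: subalgebra_def)
qed

context finite_measure_subalgebra
begin

text \<open>The conditional probability of \<open>A\<close> integrates to the probability of
  \<open>A\<close>. If that were zero, a nonnegative function with integral zero would vanish almost
  everywhere, against strict positivity. This turns overlap into positive probability of each group,
  so that conditioning on a group is meaningful.\<close>

lemma measure_pos_of_cond_exp_pos:
  assumes "measure M (space M) \<noteq> 0" and A: "A \<in> sets M"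
    and pos: "AE x in M. 0 < real_cond_exp M F (indicator A) x"
  shows "0 < measure M A"
proof (rule ccontr)
  assume "\<not> 0 < measure M A"
  then have "measure M A = 0" by (simp add: measure_nonneg order.antisym not_less)
  then have "(\<integral>x. real_cond_exp M F (indicator A) x \<partial>M) = 0"
    using A by (subst real_cond_exp_int) (auto simp: emeasure_eq_measure)
  moreover have "integrable M (real_cond_exp M F (indicator A))"
    using A by (intro real_cond_exp_int) (auto simp: emeasure_eq_measure)
  ultimately have "AE x in M. real_cond_exp M F (indicator A) x = 0"
    using pos by (subst integral_nonneg_eq_0_iff_AE[symmetric]) auto
  with pos have "AE x in M. False" by eventually_elim simp
  then have "emeasure M (space M) = 0" 
    unfolding ae_filter_eq_bot_iff[symmetric] trivial_limit_def .
  then show False using assms(1) by (simp add: measure_def)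
qed

text \<open>Bayes' rule, linking conditional expectations under \<open>uniform_measure M A\<close>
  with those under \<open>M\<close>. Over any \<open>B\<close> in \<open>F\<close>, the left side is
  an integral under the conditional measure, where \<open>Z\<close> may be exchanged for
  \<open>?h\<close>; back under \<open>M\<close>, the indicator of \<open>A\<close> is exchanged for
  \<open>?p\<close>.\<close>

lemma real_cond_exp_indicator_mult:
  fixes Z :: "'a \<Rightarrow> real"
  assumes A [measurable]: "A \<in> sets M" and pos: "0 < measure M A" and Z: "integrable M Z"
  shows "AE x in M. real_cond_exp M F (\<lambda>x. indicator A x * Z x) x =
           real_cond_exp M F (indicator A) x * real_cond_exp (uniform_measure M A) F Z x"
proof (rule real_cond_exp_charact)
  let ?U = "uniform_measure M A"
  let ?h = "real_cond_exp ?U F Z"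
  let ?p = "real_cond_exp M F (indicator A :: 'a \<Rightarrow> real)"
  interpret U: finite_measure_subalgebra ?U F
    by (intro finite_measure_subalgebra_uniform_measure pos) unfold_locales
  have [measurable]: "Z \<in> borel_measurable M" using Z by auto
  have hM [measurable]: "?h \<in> borel_measurable M"
    by (rule measurable_from_subalg[OF subalg]) auto
  show AZ: "integrable M (\<lambda>x. indicator A x * Z x)"
    using integrable_mult_indicator[OF A Z] by simp
  have ZU: "integrable ?U Z" using AZ by (simp add: integrable_uniform_measure_iff[OF A pos])
  have Ah: "integrable M (\<lambda>x. indicator A x * ?h x)"
    using U.real_cond_exp_int(1)[OF ZU] by (simp add: integrable_uniform_measure_iff[OF A pos])
  \<comment> \<open>Here \<open>?h\<close> is the \<open>F\<close>-measurable factor and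
    \<open>indicator A\<close> is what gets conditioned: integrability under \<open>M\<close> is
    known for \<open>?h\<close> on \<open>A\<close> only.\<close>
  show "integrable M (\<lambda>x. ?p x * ?h x)"
    using real_cond_exp_intg(1)[of ?h "indicator A"] Ah by (simp add: mult.commute)
  show "(\<lambda>x. ?p x * ?h x) \<in> borel_measurable F" by measurable
  fix B assume B [measurable]: "B \<in> sets F"
  have BM [measurable]: "B \<in> sets M" using B subalg by (auto simp: subalgebra_def)
  have "(\<integral>x\<in>B. indicator A x * Z x \<partial>M) = (\<integral>x. indicator A x * (indicator B x * Z x) \<partial>M)"
    by (simp add: set_lebesgue_integral_def mult_ac)
  also have "\<dots> = (\<integral>x. indicator B x * Z x \<partial>?U) * measure M A"
    using pos by (subst integral_uniform_measure_eq[OF A pos]) auto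
  also have "(\<integral>x. indicator B x * Z x \<partial>?U) = (\<integral>x. indicator B x * ?h x \<partial>?U)"
    using U.real_cond_exp_intA[OF ZU B] by (simp add: set_lebesgue_integral_def)
  also have "\<dots> * measure M A = (\<integral>x. indicator A x * (indicator B x * ?h x) \<partial>M)"
    using pos by (subst integral_uniform_measure_eq[OF A pos]) auto
  also have "\<dots> = (\<integral>x. (indicator B x * ?h x) * indicator A x \<partial>M)"
    by (simp add: mult_ac)
  also have "\<dots> = (\<integral>x. (indicator B x * ?h x) * ?p x \<partial>M)"
    using integrable_mult_indicator[OF BM Ah]
    by (intro real_cond_exp_intg(2)[symmetric]) (auto simp: mult_ac)
  also have "\<dots> = (\<integral>x\<in>B. ?p x * ?h x \<partial>M)"
    by (simp add: set_lebesgue_integral_def mult_ac)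
  finally show "(\<integral>x\<in>B. indicator A x * Z x \<partial>M) = (\<integral>x\<in>B. ?p x * ?h x \<partial>M)" .
qed

text \<open>The set \<open>N\<close> where \<open>u\<close> and \<open>v\<close> differ lies in
  \<open>F\<close> and meets \<open>A\<close> in a null set. Conditioning on \<open>F\<close> gives
  \<open>indicator N\<close> times the conditional probability of \<open>A\<close> equal to zero,
  and the second factor is positive. Thus equalities of functions of the covariates seen on one
  group hold everywhere.\<close>

lemma AE_eq_of_AE_eq_uniform_measure:
  fixes u v :: "'a \<Rightarrow> real"
  assumes A [measurable]: "A \<in> sets M" and pos: "0 < measure M A"
    and cpos: "AE x in M. 0 < real_cond_exp M F (indicator A) x"
    and [measurable]: "u \<in> borel_measurable F" "v \<in> borel_measurable F"
    and eq: "AE x in uniform_measure M A. u x = v x"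
  shows "AE x in M. u x = v x"
proof -
  define N where "N = {x \<in> space F. u x \<noteq> v x}"
  have N [measurable]: "N \<in> sets F" unfolding N_def by measurable
  then have NM [measurable]: "N \<in> sets M" using subalg by (auto simp: subalgebra_def)
  have "AE x in M. x \<in> A \<longrightarrow> u x = v x"
    using eq pos by (subst (asm) AE_uniform_measure) (auto simp: emeasure_eq_measure)
  then have 0: "AE x in M. indicator N x * indicator A x = (0::real)"
    by eventually_elim (auto simp: N_def split: split_indicator)
  have "AE x in M. real_cond_exp M F (\<lambda>x. indicator N x * indicator A x) x =
      real_cond_exp M F (\<lambda>_. 0) x"
    by (rule real_cond_exp_cong[OF 0]) auto
  moreover have "AE x in M. real_cond_exp M F (\<lambda>_. 0) x = 0"
    by (rule real_cond_exp_F_meas) auto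
  moreover have "AE x in M. real_cond_exp M F (\<lambda>x. indicator N x * indicator A x) x =
      indicator N x * real_cond_exp M F (indicator A) x"
    by (rule real_cond_exp_mult)
       (auto intro!: integrable_real_mult_indicator simp: emeasure_eq_measure)
  ultimately show ?thesis
    using cpos AE_space
  proof eventually_elim
    case (elim x)
    then show ?case
      using subalg by (auto simp: N_def subalgebra_def split: split_indicator_asm)
  qed
qed

text \<open>
  Only the whole sum is assumed integrable, not \<open>m\<close>, \<open>c i * R\<close> or \<open>c i * m\<close>. The proof therefore
  truncates to the sets on which \<open>m\<close> and all \<open>c i\<close> are bounded by \<open>n\<close>, and lets \<open>n\<close> tend to
  infinity by dominated convergence.
\<close>

lemma integral_weighted_residuals_eq_0:
  fixes R m :: "'a \<Rightarrow> real" and c :: "'i \<Rightarrow> 'a \<Rightarrow> real"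
  assumes I: "finite I"
    and A [measurable]: "\<And>i. i \<in> I \<Longrightarrow> A i \<in> sets M"
    and R: "integrable M R"
    and m [measurable]: "m \<in> borel_measurable F"
    and c [measurable]: "\<And>i. i \<in> I \<Longrightarrow> c i \<in> borel_measurable F"
    and int: "integrable M (\<lambda>x. \<Sum>i\<in>I. c i x * (indicator (A i) x * (R x - m x)))"
    and zero: "AE x in M. (\<Sum>i\<in>I. c i x * (real_cond_exp M F (\<lambda>x. indicator (A i) x * R x) x -
                 m x * real_cond_exp M F (indicator (A i)) x)) = 0"
  shows "(\<integral>x. (\<Sum>i\<in>I. c i x * (indicator (A i) x * (R x - m x))) \<partial>M) = 0"
proof -
  define \<psi> where "\<psi> x = (\<Sum>i\<in>I. c i x * (indicator (A i) x * (R x - m x)))" for x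
  define B where "B n = {x \<in> space F. \<bar>m x\<bar> \<le> real n \<and> (\<forall>i\<in>I. \<bar>c i x\<bar> \<le> real n)}" for n
  let ?q = "\<lambda>i. real_cond_exp M F (\<lambda>x. indicator (A i) x * R x)"
  let ?p = "\<lambda>i. real_cond_exp M F (indicator (A i) :: 'a \<Rightarrow> real)"
  have sp: "space F = space M" using subalg by (simp add: subalgebra_def)
  have BF [measurable]: "B n \<in> sets F" for n
    unfolding B_def using I by measurable
  have BM [measurable]: "B n \<in> sets M" for n
    using BF subalg by (auto simp: subalgebra_def)
  have RM [measurable]: "R \<in> borel_measurable M" using R by auto
  have mM [measurable]: "m \<in> borel_measurable M"
    by (rule measurable_from_subalg[OF subalg m])
  have cM [measurable]: "c i \<in> borel_measurable M" if "i \<in> I" for i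
    by (rule measurable_from_subalg[OF subalg c[OF that]])
  have trunc: "(\<integral>x. indicator (B n) x * \<psi> x \<partial>M) = 0" for n
  proof -
    \<comment> \<open>The truncated residual splits into an \<open>R\<close> part with factor
      \<open>k i\<close> and an \<open>m\<close> part with factor \<open>l i\<close>. Both factors
      are bounded and \<open>F\<close>-measurable, so each part is integrable by itself and can be
      conditioned on \<open>F\<close> separately.\<close>
    define k where "k i x = indicator (B n) x * c i x" for i x
    define l where "l i x = indicator (B n) x * c i x * m x" for i x
    have kb: "\<bar>k i x\<bar> \<le> real n" if "i \<in> I" for i x
      using that by (auto simp: k_def B_def split: split_indicator)
    have lb: "\<bar>l i x\<bar> \<le> real n * real n" if "i \<in> I" for i x
      using that by (auto simp: l_def B_def abs_mult split: split_indicator intro!: mult_mono)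
    have [measurable]: "k i \<in> borel_measurable F" "l i \<in> borel_measurable F"
      "k i \<in> borel_measurable M" "l i \<in> borel_measurable M" if "i \<in> I" for i
      using that unfolding k_def l_def by measurable
    have AR: "integrable M (\<lambda>x. indicator (A i) x * R x)" if "i \<in> I" for i
      using integrable_mult_indicator[OF A[OF that] R] by simp
    have k_int: "integrable M (\<lambda>x. k i x * (indicator (A i) x * R x))" if i: "i \<in> I" for i
    proof (rule Bochner_Integration.integrable_bound[OF integrable_mult_right[OF AR[OF i], of "real n"]])
      show "AE x in M. norm (k i x * (indicator (A i) x * R x)) \<le> norm (real n * (indicator (A i) x * R x))"
        using kb[OF i] by (intro AE_I2) (auto simp: abs_mult intro!: mult_right_mono)
    qed (use i in measurable)
    have l_int: "integrable M (\<lambda>x. l i x * indicator (A i) x)" if i: "i \<in> I" for i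
    proof (rule integrable_const_bound[where B = "real n * real n"])
      show "AE x in M. norm (l i x * indicator (A i) x) \<le> real n * real n"
        using lb[OF i] by (intro AE_I2) (auto split: split_indicator)
    qed (use i in measurable)
    have k_int': "integrable M (\<lambda>x. k i x * ?q i x)"
      and k_eq: "(\<integral>x. k i x * ?q i x \<partial>M) = (\<integral>x. k i x * (indicator (A i) x * R x) \<partial>M)"
      if i: "i \<in> I" for i
      using real_cond_exp_intg[OF k_int[OF i]] i by auto
    have l_int': "integrable M (\<lambda>x. l i x * ?p i x)"
      and l_eq: "(\<integral>x. l i x * ?p i x \<partial>M) = (\<integral>x. l i x * indicator (A i) x \<partial>M)"
      if i: "i \<in> I" for i
      using real_cond_exp_intg[OF l_int[OF i]] i by auto
    have "(\<integral>x. indicator (B n) x * \<psi> x \<partial>M) =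
        (\<integral>x. (\<Sum>i\<in>I. k i x * (indicator (A i) x * R x) - l i x * indicator (A i) x) \<partial>M)"
      by (intro Bochner_Integration.integral_cong)
         (auto simp: \<psi>_def k_def l_def sum_distrib_left algebra_simps intro!: sum.cong)
    also have "\<dots> = (\<Sum>i\<in>I. (\<integral>x. k i x * (indicator (A i) x * R x) \<partial>M) -
        (\<integral>x. l i x * indicator (A i) x \<partial>M))"
      using k_int l_int by (subst Bochner_Integration.integral_sum) (auto intro!: sum.cong)
    also have "\<dots> = (\<Sum>i\<in>I. (\<integral>x. k i x * ?q i x \<partial>M) - (\<integral>x. l i x * ?p i x \<partial>M))"
      using k_eq l_eq by (intro sum.cong) auto
    also have "\<dots> = (\<integral>x. (\<Sum>i\<in>I. k i x * ?q i x - l i x * ?p i x) \<partial>M)"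
      using k_int' l_int' by (subst Bochner_Integration.integral_sum) (auto intro!: sum.cong)
    also have "\<dots> = (\<integral>x. 0 \<partial>M)"
    proof (rule integral_cong_AE)
      show "AE x in M. (\<Sum>i\<in>I. k i x * ?q i x - l i x * ?p i x) = 0"
        using zero
      proof eventually_elim
        case (elim x)
        have "(\<Sum>i\<in>I. k i x * ?q i x - l i x * ?p i x) =
            indicator (B n) x * (\<Sum>i\<in>I. c i x * (?q i x - m x * ?p i x))"
          by (simp add: k_def l_def sum_distrib_left algebra_simps)
        with elim show ?case by simp
      qed
    qed (use k_int' l_int' in \<open>auto intro!: borel_measurable_sum borel_measurable_diff\<close>)
    finally show ?thesis by simp
  qed
  have "(\<lambda>n. \<integral>x. indicator (B n) x * \<psi> x \<partial>M) \<longlonglongrightarrow> (\<integral>x. \<psi> x \<partial>M)"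
  proof (rule integral_dominated_convergence[where w = "\<lambda>x. \<bar>\<psi> x\<bar>"])
    have psi: "integrable M \<psi>" using int unfolding \<psi>_def .
    then show "\<psi> \<in> borel_measurable M" "integrable M (\<lambda>x. \<bar>\<psi> x\<bar>)" by auto
    show "(\<lambda>x. indicator (B n) x * \<psi> x) \<in> borel_measurable M" for n
      using psi by auto
    show "AE x in M. (\<lambda>n. indicator (B n) x * \<psi> x) \<longlonglongrightarrow> \<psi> x"
    proof (intro AE_I2 tendsto_eventually)
      fix x assume x: "x \<in> space M"
      \<comment> \<open>At a fixed \<open>x\<close>, one bound dominates \<open>m\<close> and all
        the finitely many coefficients, so \<open>x\<close> belongs to \<open>B n\<close> from
        \<open>N\<close> on.\<close>
      obtain N where N: "\<bar>m x\<bar> + (\<Sum>i\<in>I. \<bar>c i x\<bar>) \<le> real N"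
        using real_arch_simple by blast
      have c_le: "\<bar>c i x\<bar> \<le> (\<Sum>i\<in>I. \<bar>c i x\<bar>)" if "i \<in> I" for i
        using that I by (intro member_le_sum) auto
      have s_ge: "0 \<le> (\<Sum>i\<in>I. \<bar>c i x\<bar>)" by (simp add: sum_nonneg)
      show "\<forall>\<^sub>F n in sequentially. indicator (B n) x * \<psi> x = \<psi> x"
        using eventually_ge_at_top[of N]
      proof eventually_elim
        case (elim n)
        have "\<bar>m x\<bar> \<le> real n" using N s_ge elim by linarith
        moreover have "\<bar>c i x\<bar> \<le> real n" if "i \<in> I" for i
          using N c_le[OF that] elim by linarith
        ultimately have "x \<in> B n" unfolding B_def using x sp by auto
        then show ?case by simp
      qed
    qed
  qed (auto split: split_indicator)
  then have "(\<lambda>n. 0) \<longlonglongrightarrow> (\<integral>x. \<psi> x \<partial>M)" by (simp add: trunc)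
  then show ?thesis unfolding \<psi>_def by (simp add: LIMSEQ_const_iff)
qed

end

text \<open>A point outside the support has a null open neighbourhood, hence a null basic one, and a
  second-countable space has only countably many of these. The lemma is what makes weights that sum
  to one on the support sum to one at \<open>X\<close> almost surely.\<close>

lemma AE_in_cov_support:
  assumes "prob_space M" and X [measurable]: "X \<in> borel_measurable M"
  shows "AE \<omega> in M. X \<omega> \<in> cov_support M X"
proof -
  interpret prob_space M by fact
  obtain \<B> :: "'b set set" where "countable \<B>" and B: "topological_basis \<B>"
    using ex_countable_basis by blast
  define \<N> where "\<N> = {U \<in> \<B>. measure M (X -` U \<inter> space M) = 0}"
  have "countable \<N>" using \<open>countable \<B>\<close> unfolding \<N>_def by simp
  have "AE \<omega> in M. \<forall>U\<in>\<N>. X \<omega> \<notin> U"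
  proof (subst AE_ball_countable[OF \<open>countable \<N>\<close>], intro ballI)
    fix U assume U: "U \<in> \<N>"
    then have "open U" using B topological_basis_open by (auto simp: \<N>_def)
    then have "X -` U \<inter> space M \<in> sets M" by measurable
    then have "X -` U \<inter> space M \<in> null_sets M"
      using U by (auto simp: \<N>_def null_sets_def emeasure_eq_measure)
    from AE_not_in[OF this] show "AE \<omega> in M. X \<omega> \<notin> U"
      using AE_space by eventually_elim auto
  qed
  then show ?thesis
    using AE_space
  proof eventually_elim
    case (elim \<omega>)
    show ?case unfolding cov_support_def
    proof (intro CollectI allI impI)
      fix U :: "'b set" assume U: "open U \<and> X \<omega> \<in> U"
      then obtain V where V: "V \<in> \<B>" "X \<omega> \<in> V" "V \<subseteq> U"
        using B topological_basisE by metis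
      then have "measure M (X -` V \<inter> space M) \<noteq> 0"
        using elim by (auto simp: \<N>_def)
      moreover have "measure M (X -` V \<inter> space M) \<le> measure M (X -` U \<inter> space M)"
        using U V by (intro finite_measure_mono) auto
      ultimately show "0 < measure M (X -` U \<inter> space M)"
        by (smt (verit) measure_nonneg)
    qed
  qed
qed

text \<open>Propensities and outcome regressions are determined only up to null sets, so they enter
  as arbitrary versions. Existence of an expectation is read as integrability of \<open>phi\<close>
  as a whole. The bound on \<open>ebar\<close> is stated over the integers, where the difference is
  not truncated at zero.\<close>

theorem corollary9:
  fixes M :: "'a measure" and Q :: "'q measure"
    and NG T n ebar e g s :: nat
    and \<gamma> :: "nat \<Rightarrow> enat"
    and G :: "'a \<Rightarrow> nat"
    and X :: "'a \<Rightarrow> 'x::euclidean_space"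
    and Y :: "nat \<Rightarrow> enat \<Rightarrow> 'a \<Rightarrow> real"
    and Smp :: "nat \<Rightarrow> 'q \<Rightarrow> (nat \<Rightarrow> real) \<times> nat \<times> 'x"
    and p :: "nat \<Rightarrow> 'x \<Rightarrow> real"
  defines "S \<equiv> obs NG T \<gamma> G X Y"
    and "D \<equiv> donors NG \<gamma> ebar g"
    and "\<pi> \<equiv> measure M (group_event M G {g})"
  assumes design: "staggered_design M NG T \<gamma> G X Y"
    and sampling: "iid_sample Q n Smp M (obs_space T) S"
    and overlap: "overlap M NG G X"
    and no_anticipation: "no_anticipation M NG T \<gamma> Y"
    and propensity: "\<And>g'. g' \<in> groups NG \<Longrightarrow>
                       regression M X (indicator (group_event M G {g'})) (p g')"
    and g: "g \<in> groups NG"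
    and s: "\<gamma> g = enat s"
    and s_ge: "2 \<le> s"
    and e_le: "e \<le> ebar"
    and ebar_le: "int ebar \<le> int T - int s"
  shows
    "(PT_stg M NG T \<gamma> G X Y ebar \<longrightarrow>
       (\<forall>w. weight_functions D (cov_support M X) w \<longrightarrow>
          (\<forall>m p'.
             regression_event M X (group_event M G D)
               (\<lambda>\<omega>. Yobs NG \<gamma> G Y (s + e) \<omega> - Yobs NG \<gamma> G Y (s - 1) \<omega>) m \<and>
             (\<forall>g'\<in>groups NG. p' g' \<in> borel_measurable borel \<and>
                (\<forall>x\<in>cov_support M X. p' g' x \<noteq> 0)) \<and>
             integrable M (\<lambda>\<omega>. phi D s g e (S \<omega>) m p' w \<pi>) \<longrightarrow>
             ATT M \<gamma> G Y g (s + e) = (\<integral>\<omega>. phi D s g e (S \<omega>) m p' w \<pi> \<partial>M)) \<and>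
          (\<forall>m'.
             m' \<in> borel_measurable borel \<and>
             integrable M (\<lambda>\<omega>. phi D s g e (S \<omega>) m' p w \<pi>) \<longrightarrow>
             ATT M \<gamma> G Y g (s + e) = (\<integral>\<omega>. phi D s g e (S \<omega>) m' p w \<pi> \<partial>M))))
     \<and>
     (SC_stg M NG T \<gamma> G X Y ebar \<longrightarrow>
       (\<forall>w. SC_weights M NG T \<gamma> G X Y ebar g w \<longrightarrow>
          (\<forall>m'.
             m' \<in> borel_measurable borel \<and>
             integrable M (\<lambda>\<omega>. phi D s g e (S \<omega>) m' p w \<pi>) \<longrightarrow>
             ATT M \<gamma> G Y g (s + e) = (\<integral>\<omega>. phi D s g e (S \<omega>) m' p w \<pi> \<partial>M))))"
proof -

  \<comment> \<open>The covariate sigma-algebra, the group events and their positive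
    probabilities\<close>
  interpret prob_space M using design by (simp add: staggered_design_def)
  have G [measurable]: "G \<in> M \<rightarrow>\<^sub>M count_space UNIV" and X [measurable]: "X \<in> borel_measurable M"
    and G_in: "\<And>\<omega>. \<omega> \<in> space M \<Longrightarrow> G \<omega> \<in> groups NG"
    and \<gamma>_in: "\<And>k. k \<in> groups NG \<Longrightarrow> \<gamma> k \<in> adoption_times T"
    and Y_int: "\<And>t a. t \<in> {1..T} \<Longrightarrow> a \<in> adoption_times T \<Longrightarrow> integrable M (Y t a)"
    using design by (auto simp: staggered_design_def)
  define F where "F = sigma_of M X"
  have "subalgebra M F"
    unfolding subalgebra_def F_def sigma_of_def
    using sets_image_in_sets[OF refl X] by simp
  then interpret finite_measure_subalgebra M F by unfold_locales
  have XF [measurable]: "X \<in> borel_measurable F"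
    unfolding F_def sigma_of_def by (rule measurable_vimage_algebra1) auto

  define A where "A k = group_event M G {k}" for k
  define P where "P k = real_cond_exp M F (indicator (A k) :: 'a \<Rightarrow> real)" for k
  \<comment> \<open>The last period before adoption; \<open>s_ge\<close> makes it a genuine period,
    at least 1.\<close>
  define t0 where "t0 = s - 1"
  define R where "R \<omega> = Y (s + e) \<infinity> \<omega> - Y t0 \<infinity> \<omega>" for \<omega>
  define \<tau> where "\<tau> \<omega> = Y (s + e) (\<gamma> g) \<omega> - Y (s + e) \<infinity> \<omega>" for \<omega>
  define H where "H k = real_cond_exp (uniform_measure M (A k)) F R" for k
  have s_eq: "s = Suc t0" and t0: "t0 \<in> {1..T}" and t1: "s + e \<in> {1..T}"
    using s_ge e_le ebar_le by (auto simp: t0_def)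
  have event: "group_event M G K \<in> sets M" for K
    using measurable_sets[OF G, of K] by (simp add: group_event_def vimage_def Int_def conj_commute)
  have A [measurable]: "A k \<in> sets M" for k unfolding A_def by (rule event)
  have D_sub: "D \<subseteq> groups NG" and fin_D: "finite D" and g_notin: "g \<notin> D"
    and D_gt: "\<And>k. k \<in> D \<Longrightarrow> enat (s + ebar) < \<gamma> k"
    using s by (auto simp: D_def donors_def groups_def)
  have Yinf: "integrable M (Y t \<infinity>)" if "t \<in> {1..T}" for t
    using that by (intro Y_int) (auto simp: adoption_times_def)
  have R_int: "integrable M R" unfolding R_def using Yinf t0 t1 by auto
  then have [measurable]: "R \<in> borel_measurable M" by auto
  have \<tau>_int: "integrable M \<tau>"
    unfolding \<tau>_def using Yinf t1 Y_int \<gamma>_in g by auto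
  then have [measurable]: "\<tau> \<in> borel_measurable M" by auto
  have Ppos: "AE \<omega> in M. 0 < P k \<omega>" if "k \<in> groups NG" for k
    using overlap that by (simp add: overlap_def P_def A_def F_def)
  have Apos: "0 < measure M (A k)" if "k \<in> groups NG" for k
    using measure_pos_of_cond_exp_pos[OF _ A Ppos[OF that, unfolded P_def]] prob_space by simp
  have \<pi>: "\<pi> = measure M (A g)" "0 < \<pi>" using Apos[OF g] by (auto simp: \<pi>_def A_def)
  have pP: "AE \<omega> in M. p k (X \<omega>) = P k \<omega>" and p_meas: "p k \<in> borel_measurable borel"
    if "k \<in> groups NG" for k
    using propensity[OF that] by (auto simp: regression_def P_def A_def F_def)
  have U: "finite_measure_subalgebra (uniform_measure M (A k)) F" if "k \<in> groups NG" for k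
    by (intro finite_measure_subalgebra_uniform_measure Apos that) unfold_locales
  have U_int: "integrable (uniform_measure M (A k)) Z" if "k \<in> groups NG" "integrable M Z" for k and Z :: "'a \<Rightarrow> real"
    using integrable_mult_indicator[OF A[of k] that(2)] that
    by (subst integrable_uniform_measure_iff[OF A Apos]) auto
  \<comment> \<open>Facts about conditional expectations within one group become facts under
    \<open>M\<close>, so that different groups can be compared at the same point.\<close>
  have transfer: "AE \<omega> in M. u \<omega> = v \<omega>"
    if "k \<in> groups NG" "u \<in> borel_measurable F" "v \<in> borel_measurable F"
      "AE \<omega> in uniform_measure M (A k). u \<omega> = v \<omega>" for k u and v :: "'a \<Rightarrow> real"
    using AE_eq_of_AE_eq_uniform_measure[OF A Apos Ppos[unfolded P_def]] that by blast
  have bayes: "AE \<omega> in M. real_cond_exp M F (\<lambda>\<omega>. indicator (A k) \<omega> * R \<omega>) \<omega> = P k \<omega> * H k \<omega>"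
    if "k \<in> groups NG" for k
    unfolding P_def H_def by (rule real_cond_exp_indicator_mult[OF A Apos[OF that] R_int])
  have XD: "AE \<omega> in M. X \<omega> \<in> cov_support M X"
    by (rule AE_in_cov_support[OF prob_space_axioms X])

  \<comment> \<open>Observed and potential outcomes\<close>
  have ATT_eq: "ATT M \<gamma> G Y g (s + e) = (\<integral>\<omega>. indicator (A g) \<omega> * \<tau> \<omega> \<partial>M) / \<pi>"
    unfolding ATT_def \<pi>(1) \<tau>_def[symmetric] A_def[symmetric]
    by (rule integral_uniform_measure_eq[OF A Apos[OF g]]) simp
  have Yobs_eq: "Yobs NG \<gamma> G Y t \<omega> = Y t (\<gamma> (G \<omega>)) \<omega>" if "\<omega> \<in> space M" for t \<omega>
  proof -
    have "Yobs NG \<gamma> G Y t \<omega> = (\<Sum>k\<in>groups NG. if G \<omega> = k then Y t (\<gamma> k) \<omega> else 0)"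
      unfolding Yobs_def by (intro sum.cong) auto
    then show ?thesis using G_in[OF that] by (simp add: groups_def)
  qed
  \<comment> \<open>Donors adopt only after \<open>s + ebar\<close>, so both \<open>t0\<close> and
    \<open>s + e\<close> precede their adoption and no anticipation applies twice.\<close>
  have donor_inf: "AE \<omega> in M. \<forall>k\<in>D. Y (s + e) (\<gamma> k) \<omega> = Y (s + e) \<infinity> \<omega> \<and> Y t0 (\<gamma> k) \<omega> = Y t0 \<infinity> \<omega>"
  proof (rule AE_finite_allI[OF fin_D])
    fix k assume k: "k \<in> D"
    have "enat (s + e) \<le> enat (s + ebar)" "enat t0 \<le> enat (s + ebar)"
      using e_le by (auto simp: t0_def)
    then have lt: "enat (s + e) < \<gamma> k" "enat t0 < \<gamma> k"
      using le_less_trans[OF _ D_gt[OF k]] by blast+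
    have na: "AE \<omega> in M. Y t (\<gamma> k) \<omega> = Y t \<infinity> \<omega>" if "t \<in> {1..T}" "enat t < \<gamma> k" for t
      using no_anticipation that D_sub k unfolding no_anticipation_def by blast
    show "AE \<omega> in M. Y (s + e) (\<gamma> k) \<omega> = Y (s + e) \<infinity> \<omega> \<and> Y t0 (\<gamma> k) \<omega> = Y t0 \<infinity> \<omega>"
      using na[OF t1 lt(1)] na[OF t0 lt(2)] by eventually_elim simp
  qed
  have g_inf: "AE \<omega> in M. Y t0 (\<gamma> g) \<omega> = Y t0 \<infinity> \<omega>"
  proof -
    have "enat t0 < \<gamma> g" using s s_eq by simp
    then show ?thesis using no_anticipation t0 g unfolding no_anticipation_def by blast
  qed

  \<comment> \<open>The moment identity under a balance condition\<close>
  define c where "c p' w i \<omega> = (if i = g then 1 else - (w i (X \<omega>) * (p' g (X \<omega>) / p' i (X \<omega>))))"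
    for p' w :: "nat \<Rightarrow> 'x \<Rightarrow> real" and i :: nat and \<omega> :: 'a
  \<comment> \<open>All three claims reduce to this fact. Its premise \<open>balance\<close> says
    that the weighted residuals have conditional mean zero given \<open>X\<close>, with the term of
    group \<open>g\<close> on one side and those of the donors on the other.\<close>
  have moment: "ATT M \<gamma> G Y g (s + e) = (\<integral>\<omega>. phi D s g e (S \<omega>) m p' w \<pi> \<partial>M)"
    if m [measurable]: "m \<in> borel_measurable borel"
      and p' [measurable]: "\<And>k. k \<in> groups NG \<Longrightarrow> p' k \<in> borel_measurable borel"
      and w: "weight_functions D (cov_support M X) w"
      and phi_int: "integrable M (\<lambda>\<omega>. phi D s g e (S \<omega>) m p' w \<pi>)"
      and balance: "AE \<omega> in M. P g \<omega> * (H g \<omega> - m (X \<omega>)) =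
            (\<Sum>k\<in>D. w k (X \<omega>) * (p' g (X \<omega>) / p' k (X \<omega>)) * (P k \<omega> * (H k \<omega> - m (X \<omega>))))"
    for m p' w
  proof -
    let ?r = "\<lambda>\<omega>. \<Sum>i\<in>insert g D. c p' w i \<omega> * (indicator (A i) \<omega> * (R \<omega> - m (X \<omega>)))"
    have cF [measurable]: "c p' w i \<in> borel_measurable F" if "i \<in> insert g D" for i
    proof -
      have "(\<lambda>\<omega>. w i (X \<omega>) * (p' g (X \<omega>) / p' i (X \<omega>))) \<in> borel_measurable F" if "i \<in> D"
      proof -
        have "w i \<in> borel_measurable borel" "p' i \<in> borel_measurable borel"
          "p' g \<in> borel_measurable borel"
          using that w p' g D_sub by (auto simp: weight_functions_def)
        then show ?thesis by measurable
      qed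
      then show ?thesis using that by (cases "i = g") (auto simp: c_def[abs_def])
    qed
    have phi_eq: "AE \<omega> in M. \<pi> * phi D s g e (S \<omega>) m p' w \<pi> = indicator (A g) \<omega> * \<tau> \<omega> + ?r \<omega>"
      using donor_inf g_inf AE_space
    proof eventually_elim
      case (elim \<omega>)
      let ?Y = "Y (s + e) (\<gamma> (G \<omega>)) \<omega> - Y t0 (\<gamma> (G \<omega>)) \<omega>"
      have ind: "indicator (A i) \<omega> = (of_bool (G \<omega> = i) :: real)" for i
        using elim by (simp add: A_def group_event_def indicator_def)
      have donor_sum: "(\<Sum>i\<in>D. c p' w i \<omega> * of_bool (G \<omega> = i)) =
          - (\<Sum>i\<in>D. w i (X \<omega>) * (p' g (X \<omega>) / p' i (X \<omega>)) * of_bool (G \<omega> = i))"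
        unfolding sum_negf[symmetric] using g_notin by (intro sum.cong) (auto simp: c_def)
      have single: "(\<Sum>i\<in>insert g D. of_bool (i = g) * z) = z" for z :: real
        unfolding sum.insert[OF fin_D g_notin] using g_notin by (subst sum.neutral) auto
      have weights: "(\<Sum>i\<in>insert g D. c p' w i \<omega> * of_bool (G \<omega> = i)) = of_bool (G \<omega> = g) -
          (\<Sum>i\<in>D. w i (X \<omega>) * (p' g (X \<omega>) / p' i (X \<omega>)) * of_bool (G \<omega> = i))"
        unfolding sum.insert[OF fin_D g_notin] donor_sum by (simp add: c_def)
      have "\<pi> * phi D s g e (S \<omega>) m p' w \<pi> =
          (\<Sum>i\<in>insert g D. c p' w i \<omega> * of_bool (G \<omega> = i)) * (?Y - m (X \<omega>))"
        using \<pi>(2) t0 t1 elim(3) unfolding weights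
        by (simp add: phi_def S_def obs_def Yobs_eq s_eq)
      also have "\<dots> = (\<Sum>i\<in>insert g D. c p' w i \<omega> * (indicator (A i) \<omega> * (?Y - m (X \<omega>))))"
        by (simp add: ind sum_distrib_right mult.assoc)
      \<comment> \<open>In group \<open>g\<close>, \<open>?Y\<close> is
        \<open>\<tau> \<omega> + R \<omega>\<close>, because \<open>t0\<close> precedes adoption; in
        a donor group it is \<open>R \<omega>\<close>. The factor \<open>of_bool (i = g)\<close>
        lets the effect enter the sum exactly once.\<close>
      also have "\<dots> = (\<Sum>i\<in>insert g D. of_bool (i = g) * (indicator (A g) \<omega> * \<tau> \<omega>) +
          c p' w i \<omega> * (indicator (A i) \<omega> * (R \<omega> - m (X \<omega>))))"
        using elim g_notin by (intro sum.cong) (auto simp: ind R_def \<tau>_def c_def)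
      also have "\<dots> = indicator (A g) \<omega> * \<tau> \<omega> + ?r \<omega>"
        using single by (simp only: sum.distrib)
      finally show ?case .
    qed
    have g\<tau>: "integrable M (\<lambda>\<omega>. indicator (A g) \<omega> * \<tau> \<omega>)"
      using integrable_mult_indicator[OF A \<tau>_int] by simp
    have cM [measurable]: "c p' w i \<in> borel_measurable M" if "i \<in> insert g D" for i
      by (rule measurable_from_subalg[OF subalg cF[OF that]])
    have r_meas [measurable]: "?r \<in> borel_measurable M" by measurable
    \<comment> \<open>Integrability of the residual sum as a whole is obtained by subtracting the
      integrable effect from the moment function.\<close>
    have phi_int': "integrable M (\<lambda>\<omega>. \<pi> * phi D s g e (S \<omega>) m p' w \<pi> - indicator (A g) \<omega> * \<tau> \<omega>)"
      using phi_int g\<tau> by auto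
    have r_int: "integrable M ?r"
      by (rule integrable_cong_AE_imp[OF phi_int' r_meas]) (use phi_eq in eventually_elim, simp)
    have "(\<integral>\<omega>. ?r \<omega> \<partial>M) = 0"
    proof (rule integral_weighted_residuals_eq_0[OF _ _ R_int _ cF r_int])
      have "AE \<omega> in M. \<forall>k\<in>insert g D.
          real_cond_exp M F (\<lambda>\<omega>. indicator (A k) \<omega> * R \<omega>) \<omega> = P k \<omega> * H k \<omega>"
        using fin_D D_sub g bayes by (intro AE_finite_allI) auto
      with balance show "AE \<omega> in M. (\<Sum>i\<in>insert g D. c p' w i \<omega> *
          (real_cond_exp M F (\<lambda>\<omega>. indicator (A i) \<omega> * R \<omega>) \<omega> -
             m (X \<omega>) * real_cond_exp M F (indicator (A i)) \<omega>)) = 0"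
      proof eventually_elim
        case (elim \<omega>)
        have "(\<Sum>i\<in>insert g D. c p' w i \<omega> *
            (real_cond_exp M F (\<lambda>\<omega>. indicator (A i) \<omega> * R \<omega>) \<omega> -
               m (X \<omega>) * real_cond_exp M F (indicator (A i)) \<omega>)) =
            (\<Sum>i\<in>insert g D. c p' w i \<omega> * (P i \<omega> * (H i \<omega> - m (X \<omega>))))"
          using elim(2) by (intro sum.cong) (auto simp: P_def algebra_simps)
        also have "\<dots> = P g \<omega> * (H g \<omega> - m (X \<omega>)) - (\<Sum>k\<in>D.
            w k (X \<omega>) * (p' g (X \<omega>) / p' k (X \<omega>)) * (P k \<omega> * (H k \<omega> - m (X \<omega>))))"
        proof -
          have "(\<Sum>i\<in>D. c p' w i \<omega> * (P i \<omega> * (H i \<omega> - m (X \<omega>)))) = - (\<Sum>k\<in>D.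
            w k (X \<omega>) * (p' g (X \<omega>) / p' k (X \<omega>)) * (P k \<omega> * (H k \<omega> - m (X \<omega>))))"
            unfolding sum_negf[symmetric] using g_notin by (intro sum.cong) (auto simp: c_def)
          then show ?thesis using fin_D g_notin by (simp add: c_def)
        qed
        finally show ?case using elim(1) by simp
      qed
    qed (use fin_D in auto)
    then have "\<pi> * (\<integral>\<omega>. phi D s g e (S \<omega>) m p' w \<pi> \<partial>M) = (\<integral>\<omega>. indicator (A g) \<omega> * \<tau> \<omega> \<partial>M)"
      using integral_cong_AE[OF _ _ phi_eq] phi_int g\<tau> r_int by simp
    then show ?thesis unfolding ATT_eq using \<pi>(2) by (simp add: field_simps)
  qed

  \<comment> \<open>Balance at the true propensities\<close>
  have balance_p: "AE \<omega> in M. P g \<omega> * (H g \<omega> - m (X \<omega>)) =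
      (\<Sum>k\<in>D. w k (X \<omega>) * (p g (X \<omega>) / p k (X \<omega>)) * (P k \<omega> * (H k \<omega> - m (X \<omega>))))"
    if w: "weight_functions D (cov_support M X) w"
      and HD: "AE \<omega> in M. H g \<omega> = (\<Sum>k\<in>D. w k (X \<omega>) * H k \<omega>)"
    for w and m :: "'x \<Rightarrow> real"
  proof -
    have "AE \<omega> in M. \<forall>k\<in>insert g D. p k (X \<omega>) = P k \<omega> \<and> 0 < P k \<omega>"
    proof (rule AE_finite_allI)
      fix k assume "k \<in> insert g D"
      then have "k \<in> groups NG" using D_sub g by auto
      from pP[OF this] Ppos[OF this] show "AE \<omega> in M. p k (X \<omega>) = P k \<omega> \<and> 0 < P k \<omega>"
        by eventually_elim simp
    qed (use fin_D in auto)
    with HD XD show ?thesis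
    proof eventually_elim
      case (elim \<omega>)
      \<comment> \<open>As \<open>p k\<close> agrees with \<open>P k\<close> and is positive,
        \<open>p g / p k * P k\<close> collapses to \<open>P g\<close> for every donor. The weights
        sum to one, so \<open>m\<close> keeps coefficient one on both sides and may be
        arbitrary.\<close>
      have "(\<Sum>k\<in>D. w k (X \<omega>) * (p g (X \<omega>) / p k (X \<omega>)) * (P k \<omega> * (H k \<omega> - m (X \<omega>)))) =
          (\<Sum>k\<in>D. P g \<omega> * (w k (X \<omega>) * H k \<omega> - w k (X \<omega>) * m (X \<omega>)))"
        using elim(3) by (intro sum.cong) (auto simp: algebra_simps)
      also have "\<dots> = P g \<omega> * ((\<Sum>k\<in>D. w k (X \<omega>) * H k \<omega>) - (\<Sum>k\<in>D. w k (X \<omega>)) * m (X \<omega>))"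
        by (simp add: sum_distrib_left sum_distrib_right sum_subtractf right_diff_distrib)
      also have "\<dots> = P g \<omega> * (H g \<omega> - m (X \<omega>))"
        using elim w by (simp add: weight_functions_def)
      finally show ?case by simp
    qed
  qed

  \<comment> \<open>Consequences of parallel trends\<close>
  have PT_H: "AE \<omega> in M. \<forall>k\<in>D. H k \<omega> = H g \<omega>" if PT: "PT_stg M NG T \<gamma> G X Y ebar"
  proof (rule AE_finite_allI[OF fin_D])
    fix k assume k: "k \<in> D"
    \<comment> \<open>The one-period increments telescope from \<open>t0\<close> to
      \<open>s + e\<close>. Setting them to zero for \<open>i > e\<close> makes \<open>f i\<close>
      integrable for every index, as the rule for conditional expectations of sums asks.\<close>
    define f where "f i \<omega> = of_bool (i \<le> e) * (Y (Suc (t0 + i)) \<infinity> \<omega> - Y (t0 + i) \<infinity> \<omega>)" for i \<omega>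
    have per: "t0 + i \<in> {1..T}" "Suc (t0 + i) \<in> {1..T}" "Suc (t0 + i) \<in> {2..T}" if "i \<le> e" for i
      using that t0 t1 s_eq by auto
    have f_int: "integrable M (f i)" for i
      using Yinf per[of i] by (cases "i \<le> e") (auto simp: f_def[abs_def])
    have R_sum: "R \<omega> = (\<Sum>i<Suc e. f i \<omega>)" for \<omega>
    proof -
      have "(\<Sum>i<Suc e. f i \<omega>) = (\<Sum>i<Suc e. Y (t0 + Suc i) \<infinity> \<omega> - Y (t0 + i) \<infinity> \<omega>)"
        by (intro sum.cong) (auto simp: f_def)
      also have "\<dots> = Y (t0 + Suc e) \<infinity> \<omega> - Y (t0 + 0) \<infinity> \<omega>"
        by (rule sum_lessThan_telescope)
      finally show ?thesis by (simp add: R_def s_eq)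
    qed
    have H_sum: "AE \<omega> in M. H j \<omega> = (\<Sum>i<Suc e. real_cond_exp (uniform_measure M (A j)) F (f i) \<omega>)"
      if j: "j \<in> groups NG" for j
    proof -
      interpret U: finite_measure_subalgebra "uniform_measure M (A j)" F by (rule U[OF j])
      show ?thesis
        unfolding H_def R_sum[abs_def]
        by (intro transfer[OF j] U.real_cond_exp_sum U_int j f_int) auto
    qed
    have "AE \<omega> in M. \<forall>i\<in>{..<Suc e}. real_cond_exp (uniform_measure M (A g)) F (f i) \<omega> =
        real_cond_exp (uniform_measure M (A k)) F (f i) \<omega>"
    proof (rule AE_finite_allI)
      fix i assume "i \<in> {..<Suc e}"
      then have i: "i \<le> e" by simp
      \<comment> \<open>\<open>Suc (t0 + i)\<close> is \<open>s + i\<close>, which stays within the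
        window from \<open>s\<close> to \<open>s + ebar\<close> because
        \<open>i \<le> e \<le> ebar\<close>.\<close>
      have "\<gamma> g \<le> enat (Suc (t0 + i))" "enat (Suc (t0 + i)) \<le> \<gamma> g + enat ebar"
        using i e_le by (auto simp: s s_eq)
      then have "AE \<omega> in M. cond_exp_event M X (A g)
            (\<lambda>\<omega>. Y (Suc (t0 + i)) \<infinity> \<omega> - Y (Suc (t0 + i) - 1) \<infinity> \<omega>) \<omega> =
          cond_exp_event M X (A k) (\<lambda>\<omega>. Y (Suc (t0 + i)) \<infinity> \<omega> - Y (Suc (t0 + i) - 1) \<infinity> \<omega>) \<omega>"
        using PT g k per(3)[OF i] unfolding PT_stg_def D_def A_def by blast
      then show "AE \<omega> in M. real_cond_exp (uniform_measure M (A g)) F (f i) \<omega> =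
          real_cond_exp (uniform_measure M (A k)) F (f i) \<omega>"
        using i by (simp add: cond_exp_event_def F_def f_def[abs_def])
    qed simp
    then show "AE \<omega> in M. H k \<omega> = H g \<omega>"
      using H_sum[OF g] H_sum[OF subsetD[OF D_sub k]]
    proof eventually_elim
      case (elim \<omega>)
      then show ?case by simp
    qed
  qed

  \<comment> \<open>An empty sum of weights would be zero instead of one on the support, where
    \<open>X\<close> lies almost surely. Nonemptiness gives the pooled donor event positive
    probability below.\<close>
  have D_ne: "D \<noteq> {}" if "weight_functions D (cov_support M X) w" for w
  proof
    assume "D = {}"
    from XD have "AE \<omega> in M. False"
      by eventually_elim (use that \<open>D = {}\<close> in \<open>auto simp: weight_functions_def\<close>)
    then show False by simp
  qed

  \<comment> \<open>The regression pooled over the donors\<close>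
  have m_eq: "AE \<omega> in M. m (X \<omega>) = H g \<omega>"
    if PT: "PT_stg M NG T \<gamma> G X Y ebar" and "D \<noteq> {}"
      and reg: "regression_event M X (group_event M G D)
            (\<lambda>\<omega>. Yobs NG \<gamma> G Y (s + e) \<omega> - Yobs NG \<gamma> G Y (s - 1) \<omega>) m" for m
  proof -
    define B where "B = group_event M G D"
    have B [measurable]: "B \<in> sets M" unfolding B_def by (rule event)
    have [measurable]: "m \<in> borel_measurable borel" using reg by (simp add: regression_event_def)
    have ind: "indicator B \<omega> = (\<Sum>k\<in>D. indicator (A k) \<omega> :: real)" if "\<omega> \<in> space M" for \<omega>
    proof -
      have "(\<Sum>k\<in>D. indicator (A k) \<omega> :: real) = (\<Sum>k\<in>D. if G \<omega> = k then 1 else 0)"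
        using that by (intro sum.cong) (auto simp: A_def group_event_def indicator_def)
      then show ?thesis
        using that fin_D by (simp add: B_def group_event_def indicator_def)
    qed
    have Pk: "AE \<omega> in M. \<forall>k\<in>D. 0 < P k \<omega> \<and>
        real_cond_exp M F (\<lambda>\<omega>. indicator (A k) \<omega> * R \<omega>) \<omega> = P k \<omega> * H k \<omega>"
    proof (rule AE_finite_allI[OF fin_D])
      fix k assume "k \<in> D"
      then have "k \<in> groups NG" using D_sub by auto
      from Ppos[OF this] bayes[OF this] show "AE \<omega> in M. 0 < P k \<omega> \<and>
        real_cond_exp M F (\<lambda>\<omega>. indicator (A k) \<omega> * R \<omega>) \<omega> = P k \<omega> * H k \<omega>"
        by eventually_elim simp
    qed
    have 1: "AE \<omega> in M. real_cond_exp M F (indicator B) \<omega> = real_cond_exp M F (\<lambda>\<omega>. \<Sum>k\<in>D. indicator (A k) \<omega>) \<omega>"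
      by (intro real_cond_exp_cong AE_I2 ind) measurable
    have 2: "AE \<omega> in M. real_cond_exp M F (\<lambda>\<omega>. \<Sum>k\<in>D. indicator (A k) \<omega>) \<omega> = (\<Sum>k\<in>D. P k \<omega>)"
      unfolding P_def by (rule real_cond_exp_sum) (simp add: emeasure_eq_measure)
    have PB: "AE \<omega> in M. real_cond_exp M F (indicator B) \<omega> = (\<Sum>k\<in>D. P k \<omega>)"
      using 1 2 by eventually_elim simp
    have cpos: "AE \<omega> in M. 0 < real_cond_exp M F (indicator B) \<omega>"
      using PB Pk by eventually_elim (auto intro!: sum_pos fin_D \<open>D \<noteq> {}\<close>)
    have pos: "0 < measure M B"
      using measure_pos_of_cond_exp_pos[OF _ B cpos] prob_space by simp
    have 3: "AE \<omega> in M. real_cond_exp M F (\<lambda>\<omega>. indicator B \<omega> * R \<omega>) \<omega> =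
        real_cond_exp M F (\<lambda>\<omega>. \<Sum>k\<in>D. indicator (A k) \<omega> * R \<omega>) \<omega>"
      by (intro real_cond_exp_cong AE_I2) (auto simp: ind sum_distrib_right)
    have 4: "AE \<omega> in M. real_cond_exp M F (\<lambda>\<omega>. \<Sum>k\<in>D. indicator (A k) \<omega> * R \<omega>) \<omega> =
        (\<Sum>k\<in>D. real_cond_exp M F (\<lambda>\<omega>. indicator (A k) \<omega> * R \<omega>) \<omega>)"
      using integrable_mult_indicator[OF A R_int] by (intro real_cond_exp_sum) simp
    \<comment> \<open>The pooled regression is the average of the \<open>H k\<close> with weights
      proportional to \<open>P k\<close>. Under parallel trends all of them equal
      \<open>H g\<close>, and the positive pooled propensity cancels.\<close>
    have EB: "AE \<omega> in M. real_cond_exp (uniform_measure M B) F R \<omega> = H g \<omega>"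
      using 3 4 real_cond_exp_indicator_mult[OF B pos R_int] PB cpos PT_H[OF PT] Pk
    proof eventually_elim
      case (elim \<omega>)
      have "real_cond_exp M F (indicator B) \<omega> * real_cond_exp (uniform_measure M B) F R \<omega> =
          (\<Sum>k\<in>D. P k \<omega> * H k \<omega>)"
        using elim by simp
      also have "\<dots> = real_cond_exp M F (indicator B) \<omega> * H g \<omega>"
        using elim by (simp add: sum_distrib_right)
      finally show ?case using elim by simp
    qed
    interpret UB: finite_measure_subalgebra "uniform_measure M B" F
      by (intro finite_measure_subalgebra_uniform_measure pos) unfold_locales
    have Yobs_meas: "(\<lambda>\<omega>. Yobs NG \<gamma> G Y t \<omega>) \<in> borel_measurable M" if "t \<in> {1..T}" for t
      unfolding Yobs_def using Y_int[OF that] \<gamma>_in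
      by (intro borel_measurable_sum borel_measurable_times) auto
    have "AE \<omega> in uniform_measure M B.
        Yobs NG \<gamma> G Y (s + e) \<omega> - Yobs NG \<gamma> G Y (s - 1) \<omega> = R \<omega>"
    proof (rule AE_uniform_measureI[OF B])
      show "AE \<omega> in M. \<omega> \<in> B \<longrightarrow> Yobs NG \<gamma> G Y (s + e) \<omega> - Yobs NG \<gamma> G Y (s - 1) \<omega> = R \<omega>"
        using donor_inf AE_space
        by eventually_elim (auto simp: B_def group_event_def Yobs_eq R_def t0_def)
    qed
    then have "AE \<omega> in uniform_measure M B. real_cond_exp (uniform_measure M B) F
          (\<lambda>\<omega>. Yobs NG \<gamma> G Y (s + e) \<omega> - Yobs NG \<gamma> G Y (s - 1) \<omega>) \<omega> =
        real_cond_exp (uniform_measure M B) F R \<omega>"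
      using Yobs_meas[OF t0] Yobs_meas[OF t1] by (intro UB.real_cond_exp_cong) (auto simp: t0_def)
    moreover have "AE \<omega> in uniform_measure M B. m (X \<omega>) = real_cond_exp (uniform_measure M B) F
          (\<lambda>\<omega>. Yobs NG \<gamma> G Y (s + e) \<omega> - Yobs NG \<gamma> G Y (s - 1) \<omega>) \<omega>"
      using reg unfolding regression_event_def B_def cond_exp_event_def F_def by blast
    ultimately have "AE \<omega> in uniform_measure M B. m (X \<omega>) = real_cond_exp (uniform_measure M B) F R \<omega>"
      by eventually_elim simp
    \<comment> \<open>The extension from \<open>B\<close> to the whole space matters because
      \<open>m\<close> is also evaluated on group \<open>g\<close>, which is disjoint from the
      donors.\<close>
    then have "AE \<omega> in M. m (X \<omega>) = real_cond_exp (uniform_measure M B) F R \<omega>"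
      by (rule AE_eq_of_AE_eq_uniform_measure[OF B pos cpos, rotated 2]) auto
    with EB show ?thesis by eventually_elim simp
  qed

  \<comment> \<open>The trend of group \<open>g\<close> as a weighted average of donor
    trends\<close>
  have PT_sum: "AE \<omega> in M. H g \<omega> = (\<Sum>k\<in>D. w k (X \<omega>) * H k \<omega>)"
    if PT: "PT_stg M NG T \<gamma> G X Y ebar" and w: "weight_functions D (cov_support M X) w" for w
    using PT_H[OF PT] XD
  proof eventually_elim
    case (elim \<omega>)
    have "(\<Sum>k\<in>D. w k (X \<omega>) * H k \<omega>) = (\<Sum>k\<in>D. w k (X \<omega>)) * H g \<omega>"
      using elim by (simp add: sum_distrib_right)
    then show ?case using w elim by (simp add: weight_functions_def)
  qed

  have SC_sum: "AE \<omega> in M. H g \<omega> = (\<Sum>k\<in>D. w k (X \<omega>) * H k \<omega>)"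
    if SC: "SC_weights M NG T \<gamma> G X Y ebar g w" for w
  proof -
    \<comment> \<open>Synthetic control speaks of levels \<open>L t k\<close>. The same weights
      serve at \<open>s + e\<close> and at \<open>t0\<close>, so subtracting the two level
      identities yields the one for trends.\<close>
    define L where "L t k = real_cond_exp (uniform_measure M (A k)) F (Y t \<infinity>)" for t k
    have L: "AE \<omega> in M. L t g \<omega> = (\<Sum>k\<in>D. w k (X \<omega>) * L t k \<omega>)"
      if "t \<in> {1..T}" "t \<le> s + ebar" for t
    proof -
      have "enat t \<le> \<gamma> g + enat ebar" using that s by simp
      then show ?thesis
        using SC that(1) unfolding SC_weights_def L_def A_def F_def D_def cond_exp_event_def by blast
    qed
    have HL: "AE \<omega> in M. H k \<omega> = L (s + e) k \<omega> - L t0 k \<omega>" if k: "k \<in> groups NG" for k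
    proof -
      interpret U: finite_measure_subalgebra "uniform_measure M (A k)" F by (rule U[OF k])
      show ?thesis unfolding H_def L_def R_def[abs_def]
        by (intro transfer[OF k] U.real_cond_exp_diff U_int k Yinf t0 t1) auto
    qed
    have "AE \<omega> in M. \<forall>k\<in>insert g D. H k \<omega> = L (s + e) k \<omega> - L t0 k \<omega>"
      using fin_D D_sub g HL by (intro AE_finite_allI) auto
    moreover have "AE \<omega> in M. L (s + e) g \<omega> = (\<Sum>k\<in>D. w k (X \<omega>) * L (s + e) k \<omega>)"
      using t1 e_le by (intro L) auto
    moreover have "AE \<omega> in M. L t0 g \<omega> = (\<Sum>k\<in>D. w k (X \<omega>) * L t0 k \<omega>)"
      using t0 by (intro L) (auto simp: t0_def)
    ultimately show ?thesis
      by eventually_elim (simp add: right_diff_distrib sum_subtractf)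
  qed

  \<comment> \<open>Assembling the three identities\<close>
  show ?thesis
  proof (intro conjI impI allI)
    fix w m p'
    assume PT: "PT_stg M NG T \<gamma> G X Y ebar" and w: "weight_functions D (cov_support M X) w"
      and *: "regression_event M X (group_event M G D)
               (\<lambda>\<omega>. Yobs NG \<gamma> G Y (s + e) \<omega> - Yobs NG \<gamma> G Y (s - 1) \<omega>) m \<and>
             (\<forall>g'\<in>groups NG. p' g' \<in> borel_measurable borel \<and>
                (\<forall>x\<in>cov_support M X. p' g' x \<noteq> 0)) \<and>
             integrable M (\<lambda>\<omega>. phi D s g e (S \<omega>) m p' w \<pi>)"
    have "AE \<omega> in M. m (X \<omega>) = H g \<omega>" using m_eq[OF PT D_ne[OF w]] * by blast
    \<comment> \<open>With \<open>m\<close> equal to \<open>H g\<close> and to every donor's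
      \<open>H k\<close>, all residual means vanish, so both sides are zero whatever
      \<open>p'\<close> and \<open>w\<close> are.\<close>
    with PT_H[OF PT] have "AE \<omega> in M. P g \<omega> * (H g \<omega> - m (X \<omega>)) =
        (\<Sum>k\<in>D. w k (X \<omega>) * (p' g (X \<omega>) / p' k (X \<omega>)) * (P k \<omega> * (H k \<omega> - m (X \<omega>))))"
      by eventually_elim simp
    then show "ATT M \<gamma> G Y g (s + e) = (\<integral>\<omega>. phi D s g e (S \<omega>) m p' w \<pi> \<partial>M)"
      using * by (intro moment w) (auto simp: regression_event_def)
  next
    fix w m'
    assume "PT_stg M NG T \<gamma> G X Y ebar" and w: "weight_functions D (cov_support M X) w"
      and "m' \<in> borel_measurable borel \<and> integrable M (\<lambda>\<omega>. phi D s g e (S \<omega>) m' p w \<pi>)"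
    then show "ATT M \<gamma> G Y g (s + e) = (\<integral>\<omega>. phi D s g e (S \<omega>) m' p w \<pi> \<partial>M)"
      by (intro moment balance_p PT_sum p_meas) auto
  next
    fix w m'
    assume SC: "SC_weights M NG T \<gamma> G X Y ebar g w"
      and "m' \<in> borel_measurable borel \<and> integrable M (\<lambda>\<omega>. phi D s g e (S \<omega>) m' p w \<pi>)"
    moreover from SC have "weight_functions D (cov_support M X) w"
      by (simp add: SC_weights_def D_def)
    ultimately show "ATT M \<gamma> G Y g (s + e) = (\<integral>\<omega>. phi D s g e (S \<omega>) m' p w \<pi> \<partial>M)"
      by (intro moment balance_p SC_sum p_meas) auto
  qed
qed

end
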